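(* Let $X$ and $Y$ be infinite dimensional complex Banach spaces, and suppose that $S\in L(X)$ and $T\in L(Y)$ satisfy property $(az)$. Then $S\oplus T\in L(X\oplus Y)$ satisfies property $(az)$ if and only if $\sigma_{uw}(S\oplus T)=\sigma_{uw}(S)\cup\sigma_{uw}(T)$.
   Context: $L(X)$ is the algebra of bounded linear operators on $X$. For a bounded operator $T$: $N(T)$ is the kernel, $R(T)$ the range, $\alpha(T)=\dim N(T)$, $\beta(T)=\operatorname{codim} R(T)$; $\sigma(T)$ is the spectrum and $\sigma_a(T)$ the approximate point spectrum. $T$ is upper semi-Fredholm if $R(T)$ is closed and $\alpha(T)<\infty$, with index $\operatorname{ind}T=\alpha(T)-\beta(T)$; it is upper semi-Weyl if moreover $\operatorname{ind}T\le 0$. $\sigma_{uw}(T)$ is the set of $\lambda\in\mathbb{C}$ such that $T-\lambda I$ is not upper semi-Weyl. The ascent is $a(T)=\inf\{n\ge 0: N(T^n)=N(T^{n+1})\}$ ($\inf\emptyset=\infty$). A point $\lambda\in\sigma_a(T)$ is a left pole of $T$ if $p=a(T-\lambda I)<\infty$ and $R((T-\lambda I)^{p+1})$ is closed; it is of finite rank if moreover $\alpha(T-\lambda I)<\infty$. $p_{00}^a(T)$ is the set of left poles of $T$ of finite rank. $T$ satisfies property $(az)$ if $\sigma(T)\setminus\sigma_{uw}(T)=p_{00}^a(T)$. *)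

theory Defs
  imports "HOL-Analysis.Analysis"
begin

text \<open>
  HOL-Analysis only provides real Banach spaces. A complex one is a real one with a multiplication
  by complex scalars that extends the real scalar multiplication and is compatible with the norm.
\<close>

class complex_normed_vector = real_normed_vector +
  fixes scaleC :: "complex \<Rightarrow> 'a \<Rightarrow> 'a"  (infixr "*\<^sub>C" 75)
  assumes scaleC_add_right: "a *\<^sub>C (x + y) = a *\<^sub>C x + a *\<^sub>C y"
    and scaleC_add_left: "(a + b) *\<^sub>C x = a *\<^sub>C x + b *\<^sub>C x"
    and scaleC_scaleC: "a *\<^sub>C (b *\<^sub>C x) = (a * b) *\<^sub>C x"
    and scaleC_one: "1 *\<^sub>C x = x"
    and scaleC_of_real: "complex_of_real r *\<^sub>C x = r *\<^sub>R x"
    and norm_scaleC: "norm (a *\<^sub>C x) = cmod a * norm x"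

class complex_banach = complex_normed_vector + complete_space

subclass (in complex_banach) banach ..

global_interpretation complex_vector:
  vector_space "scaleC :: complex \<Rightarrow> 'a \<Rightarrow> 'a :: complex_normed_vector"
  by unfold_locales (simp_all add: scaleC_add_right scaleC_add_left scaleC_scaleC scaleC_one)

text \<open>
  The direct sum of \<open>X\<close> and \<open>Y\<close> is the product type. Its norm is the library's Euclidean
  combination of the two norms, which is equivalent to the other usual choices.
\<close>

instantiation prod :: (complex_normed_vector, complex_normed_vector) complex_normed_vector
begin

definition scaleC_prod_def: "a *\<^sub>C z = (a *\<^sub>C fst z, a *\<^sub>C snd z)"

instance
proof
  fix a b :: complex and r :: real and x y :: "'a \<times> 'b"
  show "a *\<^sub>C (x + y) = a *\<^sub>C x + a *\<^sub>C y" "(a + b) *\<^sub>C x = a *\<^sub>C x + b *\<^sub>C x"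
    "a *\<^sub>C (b *\<^sub>C x) = (a * b) *\<^sub>C x" "1 *\<^sub>C x = x" "complex_of_real r *\<^sub>C x = r *\<^sub>R x"
    by (simp_all add: scaleC_prod_def prod_eq_iff scaleC_add_right scaleC_add_left scaleC_scaleC
        scaleC_one scaleC_of_real)
  have "(cmod a * norm (fst x))\<^sup>2 + (cmod a * norm (snd x))\<^sup>2
      = (cmod a)\<^sup>2 * ((norm (fst x))\<^sup>2 + (norm (snd x))\<^sup>2)"
    by (simp add: power_mult_distrib distrib_left)
  then show "norm (a *\<^sub>C x) = cmod a * norm x"
    by (simp add: scaleC_prod_def norm_prod_def norm_scaleC real_sqrt_mult)
qed

end

instance prod :: (complex_banach, complex_banach) complex_banach ..

definition cdim :: "'a :: complex_normed_vector set \<Rightarrow> enat" where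
  "cdim V = (if \<exists>B. finite B \<and> V \<subseteq> complex_vector.span B
             then enat (complex_vector.dim V) else \<infinity>)"

definition complement :: "'a :: complex_normed_vector set \<Rightarrow> 'a set \<Rightarrow> bool" where
  "complement M W \<longleftrightarrow>
     complex_vector.subspace W \<and> M \<inter> W = {0} \<and> (\<forall>x. \<exists>m\<in>M. \<exists>w\<in>W. x = m + w)"

text \<open>
  The codimension of a subspace is the dimension of any algebraic complement (equivalently, of the
  quotient space); \<open>complement_exists\<close> and \<open>codim_eq\<close> below show that it is well defined.
\<close>

definition codim :: "'a :: complex_normed_vector set \<Rightarrow> enat" where
  "codim M = (THE d. \<exists>W. complement M W \<and> d = cdim W)"

lemma cdim_complement_le:
  assumes M: "complex_vector.subspace M" and V: "complement M V" and W: "complement M W"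
  shows "cdim W \<le> cdim V"
proof (cases "\<exists>B. finite B \<and> V \<subseteq> complex_vector.span B")
  case True
  then obtain B0 where B0: "finite B0" "V \<subseteq> complex_vector.span B0" by blast
  obtain B where B: "B \<subseteq> V" "complex_vector.independent B" "V \<subseteq> complex_vector.span B"
    "card B = complex_vector.dim V"
    using complex_vector.basis_exists by blast
  have finB: "finite B"
    using complex_vector.independent_span_bound[OF B0(1) B(2)] B(1) B0(2) by blast
  have "\<forall>x. \<exists>w\<in>W. x - w \<in> M"
    using W unfolding complement_def by (metis add_diff_cancel_right')
  then obtain f where f: "\<And>x. f x \<in> W" "\<And>x. x - f x \<in> M" by metis
  have W': "complex_vector.subspace W" "M \<inter> W = {0}" using W by (auto simp: complement_def)
  have approx: "\<exists>y\<in>complex_vector.span (f ` B). x - y \<in> M" if "x \<in> complex_vector.span B" for x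
    using that
  proof (induction rule: complex_vector.span_induct_alt)
    case base
    show ?case
      using complex_vector.span_zero complex_vector.subspace_0[OF M] by (intro bexI[of _ 0]) auto
  next
    case (step c b x)
    then obtain y where y: "y \<in> complex_vector.span (f ` B)" "x - y \<in> M" by blast
    have eq: "c *\<^sub>C b + x - (c *\<^sub>C f b + y) = c *\<^sub>C (b - f b) + (x - y)"
      by (simp add: complex_vector.scale_right_diff_distrib)
    have "c *\<^sub>C b + x - (c *\<^sub>C f b + y) \<in> M"
      unfolding eq using f(2) y(2) M
      by (intro complex_vector.subspace_add complex_vector.subspace_scale)
    moreover have "c *\<^sub>C f b + y \<in> complex_vector.span (f ` B)"
      using y(1) step(1)
      by (simp add: complex_vector.span_add complex_vector.span_scale complex_vector.span_base)
    ultimately show ?case by blast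
  qed
  have sub: "W \<subseteq> complex_vector.span (f ` B)"
  proof
    fix w assume w: "w \<in> W"
    obtain m v where mv: "m \<in> M" "v \<in> V" "w = m + v"
      using V unfolding complement_def by blast
    obtain y where y: "y \<in> complex_vector.span (f ` B)" "v - y \<in> M"
      using approx mv(2) B(3) by blast
    have "complex_vector.span (f ` B) \<subseteq> W"
      using f(1) W'(1) by (intro complex_vector.span_minimal) auto
    then have "w - y \<in> W" using w y(1) W'(1) by (blast intro: complex_vector.subspace_diff)
    moreover have "w - y = m + (v - y)" using mv by simp
    then have "w - y \<in> M" using complex_vector.subspace_add[OF M mv(1) y(2)] by (simp only:)
    ultimately have "w - y = 0" using W'(2) by blast
    then show "w \<in> complex_vector.span (f ` B)" using y(1) by simp
  qed
  have "complex_vector.dim W \<le> card (f ` B)"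
    using complex_vector.dim_le_card[OF sub] finB by simp
  also have "\<dots> \<le> complex_vector.dim V" using card_image_le[OF finB] B(4) by metis
  finally have "complex_vector.dim W \<le> complex_vector.dim V" .
  moreover have "\<exists>B. finite B \<and> W \<subseteq> complex_vector.span B"
    using sub finB by blast
  ultimately show ?thesis using True by (simp add: cdim_def)
qed (auto simp: cdim_def)

lemma complement_exists:
  assumes M: "complex_vector.subspace M"
  shows "\<exists>W. complement M W"
proof -
  interpret vp: vector_space_pair
    "scaleC :: complex \<Rightarrow> 'a \<Rightarrow> 'a" "scaleC :: complex \<Rightarrow> 'a \<Rightarrow> 'a"
    by unfold_locales
  obtain g where g: "range g \<subseteq> M" "Vector_Spaces.linear scaleC scaleC g" "\<forall>v\<in>M. g (id v) = v"
    using vp.linear_exists_left_inverse_on[of id M] complex_vector.linear_id M by auto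
  interpret g: Vector_Spaces.linear scaleC scaleC g by (fact g(2))
  have "complement M {x. g x = 0}"
    unfolding complement_def
  proof (intro conjI allI)
    show "complex_vector.subspace {x. g x = 0}" by (fact g.subspace_kernel)
    show "M \<inter> {x. g x = 0} = {0}" using g(3) complex_vector.subspace_0[OF M] by auto
    fix x
    have "g (g x) = g x" using g(1,3) by auto
    then have "x - g x \<in> {x. g x = 0}" by (simp add: g.diff)
    moreover have "g x \<in> M" using g(1) by blast
    ultimately show "\<exists>m\<in>M. \<exists>w\<in>{x. g x = 0}. x = m + w"
      by (intro bexI[of _ "g x"] bexI[of _ "x - g x"]) auto
  qed
  then show ?thesis by blast
qed

lemma codim_eq:
  assumes "complex_vector.subspace M" and "complement M W"
  shows "codim M = cdim W"
  unfolding codim_def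
  using assms by (intro the_equality) (auto intro: antisym cdim_complement_le)

text \<open>Membership in \<open>L(X)\<close> (more generally, in the bounded linear maps \<open>X \<rightarrow> Y\<close>).\<close>

definition bounded_clinear ::
    "('a :: complex_normed_vector \<Rightarrow> 'b :: complex_normed_vector) \<Rightarrow> bool" where
  "bounded_clinear T \<longleftrightarrow> bounded_linear T \<and> (\<forall>c x. T (c *\<^sub>C x) = c *\<^sub>C T x)"

definition shift :: "('a :: complex_normed_vector \<Rightarrow> 'a) \<Rightarrow> complex \<Rightarrow> 'a \<Rightarrow> 'a" where
  "shift T l = (\<lambda>x. T x - l *\<^sub>C x)"

definition spectrum :: "('a :: complex_normed_vector \<Rightarrow> 'a) \<Rightarrow> complex set" where
  "spectrum T =
     {l. \<not> (\<exists>U. bounded_clinear U \<and> shift T l \<circ> U = id \<and> U \<circ> shift T l = id)}"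

definition approximate_point_spectrum :: "('a :: complex_normed_vector \<Rightarrow> 'a) \<Rightarrow> complex set" where
  "approximate_point_spectrum T =
     {l. \<exists>x :: nat \<Rightarrow> 'a. (\<forall>n. norm (x n) = 1) \<and> (\<lambda>n. shift T l (x n)) \<longlonglongrightarrow> 0}"

definition kernel :: "('a :: complex_normed_vector \<Rightarrow> 'b :: complex_normed_vector) \<Rightarrow> 'a set" where
  "kernel T = {x. T x = 0}"

definition nullity :: "('a :: complex_normed_vector \<Rightarrow> 'a) \<Rightarrow> enat" where
  "nullity T = cdim (kernel T)"

definition deficiency :: "('a :: complex_normed_vector \<Rightarrow> 'a) \<Rightarrow> enat" where
  "deficiency T = codim (range T)"

definition upper_semi_Fredholm :: "('a :: complex_normed_vector \<Rightarrow> 'a) \<Rightarrow> bool" where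
  "upper_semi_Fredholm T \<longleftrightarrow> closed (range T) \<and> nullity T < \<infinity>"

text \<open>Only used when \<open>nullity T\<close> is finite, so that the difference makes sense; it may be \<open>-\<infinity>\<close>.\<close>

definition index :: "('a :: complex_normed_vector \<Rightarrow> 'a) \<Rightarrow> ereal" where
  "index T = ereal_of_enat (nullity T) - ereal_of_enat (deficiency T)"

definition upper_semi_Weyl :: "('a :: complex_normed_vector \<Rightarrow> 'a) \<Rightarrow> bool" where
  "upper_semi_Weyl T \<longleftrightarrow> upper_semi_Fredholm T \<and> index T \<le> 0"

definition upper_semi_Weyl_spectrum :: "('a :: complex_normed_vector \<Rightarrow> 'a) \<Rightarrow> complex set" where
  "upper_semi_Weyl_spectrum T = {l. \<not> upper_semi_Weyl (shift T l)}"

text \<open>In \<^typ>\<open>enat\<close>, the infimum of the empty set is \<open>\<infinity>\<close>.\<close>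

definition ascent :: "('a :: complex_normed_vector \<Rightarrow> 'a) \<Rightarrow> enat" where
  "ascent T = Inf {enat n | n. kernel (T ^^ n) = kernel (T ^^ Suc n)}"

definition left_pole :: "('a :: complex_normed_vector \<Rightarrow> 'a) \<Rightarrow> complex \<Rightarrow> bool" where
  "left_pole T l \<longleftrightarrow> l \<in> approximate_point_spectrum T \<and>
     (\<exists>p. ascent (shift T l) = enat p \<and> closed (range (shift T l ^^ (p + 1))))"

definition left_poles_finite_rank :: "('a :: complex_normed_vector \<Rightarrow> 'a) \<Rightarrow> complex set" where
  "left_poles_finite_rank T = {l. left_pole T l \<and> nullity (shift T l) < \<infinity>}"

definition property_az :: "('a :: complex_normed_vector \<Rightarrow> 'a) \<Rightarrow> bool" where
  "property_az T \<longleftrightarrow> spectrum T - upper_semi_Weyl_spectrum T = left_poles_finite_rank T"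

abbreviation direct_sum :: "('a \<Rightarrow> 'a) \<Rightarrow> ('b \<Rightarrow> 'b) \<Rightarrow> 'a \<times> 'b \<Rightarrow> 'a \<times> 'b"
    (infixr "\<oplus>\<^sub>o" 65) where
  "S \<oplus>\<^sub>o T \<equiv> map_prod S T"

end

theory Submission
  imports Defs
begin

text \<open>
  The idea is to replace the upper semi-Weyl spectrum, which does not split over direct sums, by the
  upper semi-Browder spectrum, which does. Call an operator upper semi-Browder if it is upper
  semi-Fredholm and has finite ascent, and let \<open>\<sigma>\<^sub>u\<^sub>b(T)\<close> be the corresponding spectrum. Three facts carry
  the proof.

  \<^item> Left poles of finite rank are exactly the points of \<open>\<sigma>\<^sub>a(T)\<close> outside \<open>\<sigma>\<^sub>u\<^sub>b(T)\<close>
    (\<open>left_poles_finite_rank_eq\<close>). For an operator \<open>A\<close> with finite nullity one has to see that \<open>R(A)\<close> is closed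
    if and only if \<open>R(A\<^sup>n)\<close> is, for \<open>n \<ge> 1\<close>. Both directions rest on the open mapping theorem and on the
    closedness of finite-dimensional extensions of closed subspaces.

  \<^item> Upper semi-Browder operators are upper semi-Weyl (\<open>upper_semi_Browder_imp_Weyl\<close>). If
    \<open>K = N(A\<^sup>n)\<close> is the stable kernel, then \<open>A\<close> maps \<open>K\<close> into \<open>K\<close> and \<open>R(A) \<inter> K = A(K)\<close>; so \<open>K / A(K)\<close>, which has
    dimension \<open>\<alpha>(A)\<close>, embeds into \<open>X / R(A)\<close>.

  \<^item> \<open>\<sigma>\<^sub>u\<^sub>b(S \<oplus> T) = \<sigma>\<^sub>u\<^sub>b(S) \<union> \<sigma>\<^sub>u\<^sub>b(T)\<close>, since kernels, ranges and powers are formed componentwise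
    (\<open>upper_semi_Browder_spectrum_map_prod\<close>).

  By the first two facts and the inclusions of \<open>\<sigma>\<^sub>a(T)\<close> and \<open>\<sigma>\<^sub>u\<^sub>b(T)\<close> in \<open>\<sigma>(T)\<close>, property \<open>(az)\<close>
  for \<open>T\<close> means that \<open>\<sigma>\<^sub>u\<^sub>w(T) = \<sigma>\<^sub>u\<^sub>b(T)\<close> and \<open>\<sigma>(T) - \<sigma>\<^sub>u\<^sub>w(T) \<subseteq> \<sigma>\<^sub>a(T)\<close> (\<open>property_az_iff\<close>). When \<open>S\<close> and
  \<open>T\<close> have the property, the third fact says that \<open>\<sigma>\<^sub>u\<^sub>b(S \<oplus> T) = \<sigma>\<^sub>u\<^sub>w(S) \<union> \<sigma>\<^sub>u\<^sub>w(T)\<close>. So the equation for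
  \<open>\<sigma>\<^sub>u\<^sub>w(S \<oplus> T)\<close> in the theorem is the first of the two conditions for \<open>S \<oplus> T\<close>. It entails the second:
  a point of \<open>\<sigma>(S \<oplus> T)\<close> outside both Weyl spectra lies in \<open>\<sigma>(S)\<close> or in \<open>\<sigma>(T)\<close>, hence in \<open>\<sigma>\<^sub>a(S)\<close> or
  \<open>\<sigma>\<^sub>a(T)\<close> by the second condition for that summand, and both are contained in \<open>\<sigma>\<^sub>a(S \<oplus> T)\<close>.
\<close>

section \<open>Bounded complex-linear operators\<close>

lemma bounded_clinear_imp_linear:
  assumes "bounded_clinear T"
  shows "Vector_Spaces.linear scaleC scaleC T"
  using assms unfolding bounded_clinear_def
  by unfold_locales (auto simp: bounded_linear.axioms linear_add)

lemma subspace_kernel: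
  assumes "Vector_Spaces.linear scaleC scaleC f"
  shows "complex_vector.subspace (kernel f)"
  unfolding kernel_def
  by (rule module_hom.subspace_kernel[OF Vector_Spaces.linear.axioms(3)[OF assms]])

lemma zero_in_kernel: "bounded_clinear T \<Longrightarrow> 0 \<in> kernel T"
  using complex_vector.subspace_0[OF subspace_kernel[OF bounded_clinear_imp_linear]] .

lemma bounded_clinear_compose:
  assumes "bounded_clinear g" "bounded_clinear f"
  shows "bounded_clinear (g \<circ> f)"
  using assms unfolding bounded_clinear_def o_def by (auto intro: bounded_linear_compose)

lemma bounded_clinear_funpow:
  fixes T :: "'a :: complex_normed_vector \<Rightarrow> 'a"
  assumes "bounded_clinear T"
  shows "bounded_clinear (T ^^ n)"
proof (induction n)
  case 0
  show ?case by (simp add: bounded_clinear_def id_def bounded_linear_ident)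
next
  case (Suc n)
  then show ?case using bounded_clinear_compose[OF assms] by (simp only: funpow.simps)
qed

lemma bounded_clinear_shift:
  assumes "bounded_clinear T"
  shows "bounded_clinear (shift T l)"
proof -
  have "bounded_linear (\<lambda>x :: 'a. l *\<^sub>C x)"
    by (rule bounded_linear_intro[where K = "cmod l"])
      (simp_all add: scaleC_add_right norm_scaleC scaleC_scaleC mult.commute flip: scaleC_of_real)
  then show ?thesis
    using assms unfolding bounded_clinear_def shift_def
    by (auto intro: bounded_linear_sub simp: complex_vector.scale_right_diff_distrib scaleC_scaleC mult.commute)
qed

lemma bounded_clinear_map_prod:
  assumes "bounded_clinear S" "bounded_clinear T"
  shows "bounded_clinear (S \<oplus>\<^sub>o T)"
proof -
  have "S \<oplus>\<^sub>o T = (\<lambda>z. (S (fst z), T (snd z)))" by auto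
  then show ?thesis
    using assms unfolding bounded_clinear_def
    by (auto simp: scaleC_prod_def intro!: bounded_linear_Pair
        intro: bounded_linear_compose[OF _ bounded_linear_fst] bounded_linear_compose[OF _ bounded_linear_snd])
qed

section \<open>Finite-dimensional subspaces\<close>

lemma cdim_finite_iff:
  "cdim V < \<infinity> \<longleftrightarrow> (\<exists>B. finite B \<and> V \<subseteq> complex_vector.span B)"
  by (auto simp: cdim_def)

lemma cdim_finite_subset: "cdim W < \<infinity>" if "cdim V < \<infinity>" "W \<subseteq> V"
  using that unfolding cdim_finite_iff by blast

lemma finite_basis:
  assumes "cdim V < \<infinity>"
  obtains B where "finite B" "B \<subseteq> V" "complex_vector.independent B" "V \<subseteq> complex_vector.span B"
    "card B = complex_vector.dim V"
proof -
  obtain B where B: "B \<subseteq> V" "complex_vector.independent B" "V \<subseteq> complex_vector.span B"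
    "card B = complex_vector.dim V"
    using complex_vector.basis_exists by blast
  moreover have "finite B"
    using assms B(1,2) complex_vector.independent_span_bound unfolding cdim_finite_iff by blast
  ultimately show thesis using that by blast
qed

lemma dim_mono_finite:
  assumes "cdim V < \<infinity>" "W \<subseteq> V"
  shows "complex_vector.dim W \<le> complex_vector.dim V"
  using assms by (metis finite_basis complex_vector.dim_le_card subset_trans)

lemma cdim_finite_image:
  assumes f: "Vector_Spaces.linear scaleC scaleC f" and "cdim V < \<infinity>"
  shows "cdim (f ` V) < \<infinity>"
proof -
  interpret f: Vector_Spaces.linear scaleC scaleC f by (fact f)
  show ?thesis
    using assms(2) unfolding cdim_finite_iff by (metis f.span_image finite_imageI image_mono)
qed

lemma cdim_finite_sums:
  assumes "cdim V < \<infinity>" "cdim W < \<infinity>" "U \<subseteq> {v + w | v w. v \<in> V \<and> w \<in> W}"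
  shows "cdim U < \<infinity>"
proof -
  obtain B C where "finite B" "V \<subseteq> complex_vector.span B" "finite C" "W \<subseteq> complex_vector.span C"
    using assms(1,2) unfolding cdim_finite_iff by blast
  then have "finite (B \<union> C)" "U \<subseteq> complex_vector.span (B \<union> C)"
    using assms(3) unfolding complex_vector.span_Un by blast+
  then show ?thesis unfolding cdim_finite_iff by blast
qed

text \<open>
  A linear right inverse \<open>g\<close> of \<open>f\<close> on its range splits every \<open>x\<close> as \<open>g (f x)\<close> plus an element of the
  kernel. This is what keeps the kernels of all powers of an operator finite-dimensional.
\<close>

lemma cdim_finite_vimage:
  assumes f: "Vector_Spaces.linear scaleC scaleC f"
    and ker: "cdim (kernel f) < \<infinity>" and U: "cdim U < \<infinity>"
  shows "cdim (f -` U) < \<infinity>"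
proof -
  interpret f: Vector_Spaces.linear scaleC scaleC f by (fact f)
  interpret vector_space_pair "scaleC :: complex \<Rightarrow> 'a \<Rightarrow> 'a" "scaleC :: complex \<Rightarrow> 'b \<Rightarrow> 'b"
    by unfold_locales
  obtain g where g: "Vector_Spaces.linear scaleC scaleC g" "\<And>y. y \<in> range f \<Longrightarrow> f (g y) = y"
    using linear_exists_right_inverse_on[OF f complex_vector.subspace_UNIV] by blast
  have "x = g (f x) + (x - g (f x))" "x - g (f x) \<in> kernel f" for x
    using g(2) by (auto simp: kernel_def f.diff)
  then have "f -` U \<subseteq> {v + w | v w. v \<in> g ` U \<and> w \<in> kernel f}" by blast
  then show ?thesis
    using cdim_finite_sums[OF cdim_finite_image[OF g(1) U] ker] by blast
qed

lemma cdim_finite_Times_iff: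
  fixes V :: "'a :: complex_normed_vector set" and W :: "'b :: complex_normed_vector set"
  assumes "V \<noteq> {}" "W \<noteq> {}"
  shows "cdim (V \<times> W) < \<infinity> \<longleftrightarrow> cdim V < \<infinity> \<and> cdim W < \<infinity>"
proof -
  have lin: "Vector_Spaces.linear scaleC scaleC (fst :: 'a \<times> 'b \<Rightarrow> 'a)"
    "Vector_Spaces.linear scaleC scaleC (snd :: 'a \<times> 'b \<Rightarrow> 'b)"
    "Vector_Spaces.linear scaleC scaleC (\<lambda>x :: 'a. (x, 0 :: 'b))"
    "Vector_Spaces.linear scaleC scaleC (\<lambda>y :: 'b. (0 :: 'a, y))"
    by (unfold_locales; simp add: scaleC_prod_def)+
  have sums: "V \<times> W \<subseteq> {v + w | v w. v \<in> (\<lambda>x. (x, 0)) ` V \<and> w \<in> (\<lambda>y. (0, y)) ` W}"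
    by force
  have proj: "fst ` (V \<times> W) = V" "snd ` (V \<times> W) = W" using assms by auto
  show ?thesis
    using cdim_finite_image[OF lin(1), of "V \<times> W"] cdim_finite_image[OF lin(2), of "V \<times> W"]
      cdim_finite_sums[OF cdim_finite_image[OF lin(3)] cdim_finite_image[OF lin(4)] sums]
    unfolding proj by blast
qed

text \<open>
  Rank-nullity on a finite-dimensional subspace of an arbitrary space: a basis of the part killed by
  \<open>f\<close> is extended to a basis of \<open>K\<close>, and \<open>f\<close> maps the added vectors \<open>F\<close> bijectively to a basis of the image.
\<close>

lemma rank_nullity:
  assumes f: "Vector_Spaces.linear scaleC scaleC f"
    and K: "complex_vector.subspace K" and fin: "cdim K < \<infinity>"
  shows "complex_vector.dim K = complex_vector.dim (K \<inter> kernel f) + complex_vector.dim (f ` K)"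
proof -
  interpret f: Vector_Spaces.linear scaleC scaleC f by (fact f)
  have "cdim (K \<inter> kernel f) < \<infinity>" using cdim_finite_subset[OF fin] by blast
  then obtain E where E: "E \<subseteq> K \<inter> kernel f" "complex_vector.independent E"
    "K \<inter> kernel f \<subseteq> complex_vector.span E" "card E = complex_vector.dim (K \<inter> kernel f)"
    by (rule finite_basis)
  obtain B where B: "E \<subseteq> B" "B \<subseteq> K" "complex_vector.independent B" "K \<subseteq> complex_vector.span B"
    using complex_vector.maximal_independent_subset_extend[of E K] E(1,2) by blast
  define F where "F = B - E"
  have finB: "finite B"
    using fin B(2,3) complex_vector.independent_span_bound unfolding cdim_finite_iff by blast
  have spanB: "complex_vector.span B = K"
    using B(2,4) K by (simp add: complex_vector.span_minimal subset_antisym)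
  have "x = 0" if x: "x \<in> complex_vector.span F" "f x = 0" for x
  proof -
    have "x \<in> K" using x(1) spanB complex_vector.span_mono[of F B] by (auto simp: F_def)
    then have "x \<in> complex_vector.span E" using E(3) x(2) by (auto simp: kernel_def)
    then have eqs: "complex_vector.representation B x = complex_vector.representation E x"
      "complex_vector.representation B x = complex_vector.representation F x"
      using complex_vector.representation_extend[OF B(3) _ B(1)]
        complex_vector.representation_extend[OF B(3) x(1)] by (simp_all add: F_def Diff_subset)
    \<comment> \<open>The support of the coordinates of \<open>x\<close> lies both in \<open>E\<close> and in the disjoint set \<open>F\<close>.\<close>
    have "complex_vector.representation B x b = 0" for b
      using eqs complex_vector.representation_ne_zero[of _ x b] by (metis DiffD2 F_def)
    then show "x = 0"
      using complex_vector.sum_nonzero_representation_eq[OF B(3)] \<open>x \<in> K\<close> spanB by fastforce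
  qed
  then have inj: "inj_on f (complex_vector.span F)"
    by (simp add: f.inj_on_iff_eq_0)
  have "complex_vector.independent F"
    using B(3) by (rule complex_vector.independent_mono) (auto simp: F_def)
  then have ind: "complex_vector.independent (f ` F)"
    using inj by (rule f.independent_injective_image)
  have "f ` K = f ` complex_vector.span F"
  proof (intro equalityI subsetI)
    fix y assume "y \<in> f ` K"
    then obtain x where x: "x \<in> complex_vector.span (E \<union> F)" "y = f x"
      using spanB B(1) by (auto simp: F_def Un_absorb1)
    then obtain u v where uv: "u \<in> complex_vector.span E" "v \<in> complex_vector.span F" "x = u + v"
      unfolding complex_vector.span_Un by blast
    have "f u = 0" using f.eq_0_on_span[OF _ uv(1)] E(1) by (auto simp: kernel_def)
    then show "y \<in> f ` complex_vector.span F" using uv x(2) by (simp add: f.add)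
  qed (use spanB complex_vector.span_mono[of F B] in \<open>auto simp: F_def\<close>)
  then have "complex_vector.dim (f ` K) = card (f ` F)"
    using ind by (simp add: f.span_image[symmetric] complex_vector.dim_eq_card_independent)
  also have "\<dots> = card F"
    using inj complex_vector.span_superset by (metis card_image inj_on_subset)
  finally have "complex_vector.dim (f ` K) = card F" .
  moreover have "card B = card E + card F"
    using finB B(1) by (simp add: F_def card_Diff_subset card_mono finite_subset)
  moreover have "card B = complex_vector.dim K"
    using B by (simp add: complex_vector.basis_card_eq_dim)
  ultimately show ?thesis using E(4) by simp
qed

text \<open>
  The projection along \<open>M\<close> onto a complement stands in for the quotient map by \<open>M\<close>, so that \<open>codim\<close> becomes
  the dimension of a range and rank-nullity can be applied to it.
\<close>

lemma projection_along_exists: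
  fixes M :: "'a :: complex_normed_vector set"
  assumes M: "complex_vector.subspace M"
  obtains g :: "'a \<Rightarrow> 'a" where "Vector_Spaces.linear scaleC scaleC g" "kernel g = M" "complement M (range g)"
proof -
  obtain W where W: "complement M W" using complement_exists[OF M] by blast
  then have sW: "complex_vector.subspace W" by (simp add: complement_def)
  define h where "h = (\<lambda>x. SOME w. w \<in> W \<and> x - w \<in> M)"
  have h: "h x \<in> W \<and> x - h x \<in> M" for x
    unfolding h_def by (rule someI_ex) (use W in \<open>metis complement_def add_diff_cancel_right'\<close>)
  have h_unique: "h x = w" if "w \<in> W" "x - w \<in> M" for x w
  proof -
    have "(x - w) - (x - h x) \<in> M" using that h M complex_vector.subspace_diff by blast
    moreover have "h x - w \<in> W" using that h sW complex_vector.subspace_diff by blast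
    ultimately have "h x - w \<in> M \<inter> W" by simp
    then have "h x - w = 0" using W unfolding complement_def by blast
    then show ?thesis by simp
  qed
  have "h (x + y) = h x + h y" for x y
  proof (rule h_unique)
    show "h x + h y \<in> W" using h sW complex_vector.subspace_add by blast
    have "(x - h x) + (y - h y) \<in> M" using h M complex_vector.subspace_add by blast
    then show "x + y - (h x + h y) \<in> M" by (simp add: algebra_simps)
  qed
  moreover have "h (c *\<^sub>C x) = c *\<^sub>C h x" for c x
  proof (rule h_unique)
    show "c *\<^sub>C h x \<in> W" using h sW complex_vector.subspace_scale by blast
    have "c *\<^sub>C (x - h x) \<in> M" using h M complex_vector.subspace_scale by blast
    then show "c *\<^sub>C x - c *\<^sub>C h x \<in> M" by (simp add: complex_vector.scale_right_diff_distrib)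
  qed
  ultimately have "Vector_Spaces.linear scaleC scaleC h" by unfold_locales auto
  moreover have "kernel h = M"
    using h h_unique[OF complex_vector.subspace_0[OF sW]] unfolding kernel_def
    by (metis (mono_tags, lifting) Collect_cong Collect_mem_eq diff_zero)
  moreover have "range h = W"
  proof (intro equalityI subsetI)
    fix w assume "w \<in> W"
    then have "h w = w" using h_unique complex_vector.subspace_0[OF M] by simp
    then show "w \<in> range h" by (metis rangeI)
  qed (use h in auto)
  ultimately show thesis using W that by blast
qed

text \<open>
  The algebraic reason why finite ascent forces a nonpositive index. As \<open>f\<close> maps \<open>K\<close> into itself,
  \<open>dim (K / f K)\<close> is the dimension of the kernel of \<open>f\<close> on \<open>K\<close>, and this is the whole kernel. As \<open>f\<close> maps
  nothing from outside into \<open>K\<close>, the range of \<open>f\<close> meets \<open>K\<close> exactly in \<open>f K\<close>, so that \<open>K / f K\<close> embeds into the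
  quotient by the range. The map \<open>g\<close> below plays the part of the map into that quotient.
\<close>

lemma cdim_kernel_le_codim_range:
  fixes f :: "'a :: complex_normed_vector \<Rightarrow> 'a"
  assumes f: "Vector_Spaces.linear scaleC scaleC f"
    and K: "complex_vector.subspace K" "cdim K < \<infinity>" "f -` K = K"
  shows "cdim (kernel f) \<le> codim (range f)"
proof -
  interpret f: Vector_Spaces.linear scaleC scaleC f by (fact f)
  have sub: "complex_vector.subspace (range f)"
    by (simp add: f.subspace_image)
  then obtain g where g: "Vector_Spaces.linear scaleC scaleC g" "kernel g = range f"
    "complement (range f) (range g)"
    by (rule projection_along_exists)
  have codim: "codim (range f) = cdim (range g)" using codim_eq[OF sub g(3)] .
  have "kernel f \<subseteq> K" using K(3) complex_vector.subspace_0[OF K(1)] by (auto simp: kernel_def)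
  then have ker: "K \<inter> kernel f = kernel f" and fin: "cdim (kernel f) < \<infinity>"
    using cdim_finite_subset[OF K(2)] by auto
  have "K \<inter> kernel g = f ` K" using K(3) g(2) by auto
  then have "complex_vector.dim (kernel f) = complex_vector.dim (g ` K)"
    using rank_nullity[OF f K(1,2)] rank_nullity[OF g(1) K(1,2)] ker by simp
  then have "cdim (range g) < \<infinity> \<Longrightarrow> complex_vector.dim (kernel f) \<le> complex_vector.dim (range g)"
    using dim_mono_finite[of "range g" "g ` K"] by auto
  then show ?thesis using fin codim by (auto simp: cdim_def split: if_splits)
qed

section \<open>Finite-dimensional extensions of closed subspaces\<close>

lemma tendsto_scaleC_left:
  fixes b :: "'a :: complex_normed_vector"
  assumes "k \<longlonglongrightarrow> l"
  shows "(\<lambda>n. k n *\<^sub>C b) \<longlonglongrightarrow> l *\<^sub>C b"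
proof -
  have "bounded_linear (\<lambda>k. k *\<^sub>C b)"
    by (rule bounded_linear_intro[where K = "norm b"])
      (auto simp: scaleC_add_left norm_scaleC scaleC_scaleC scaleR_conv_of_real
        simp flip: scaleC_of_real)
  then show ?thesis using assms by (rule bounded_linear.tendsto)
qed

text \<open>
  If \<open>b\<close> has distance at least \<open>d > 0\<close> from the closed subspace, the coefficient of \<open>b\<close> in a vector is bounded by
  the norm of the vector divided by \<open>d\<close>. Coefficients along a convergent sequence are then Cauchy, and
  subtracting their limit leads back to the closed subspace.
\<close>

lemma closed_span_insert:
  fixes b :: "'a :: complex_normed_vector"
  assumes closed: "closed (complex_vector.span S)"
  shows "closed (complex_vector.span (insert b S))"
proof (cases "b \<in> complex_vector.span S")
  case True
  then show ?thesis using closed by (simp add: complex_vector.span_redundant)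
next
  case False
  then obtain d where "d > 0" "\<And>v. dist v b < d \<Longrightarrow> v \<in> - complex_vector.span S"
    using closed unfolding closed_def open_dist by blast
  then have d: "d > 0" "\<And>v. v \<in> complex_vector.span S \<Longrightarrow> d \<le> norm (v - b)"
    by (force simp: dist_norm not_less[symmetric])+
  have bound: "cmod k * d \<le> norm (m + k *\<^sub>C b)" if m: "m \<in> complex_vector.span S" for m k
  proof (cases "k = 0")
    case False
    have "d \<le> norm ((- 1 / k) *\<^sub>C m - b)"
      using d(2) complex_vector.span_scale[OF m] by blast
    then have "cmod k * d \<le> norm ((- k) *\<^sub>C ((- 1 / k) *\<^sub>C m - b))"
      by (simp add: norm_scaleC mult_left_mono)
    also have "(- k) *\<^sub>C ((- 1 / k) *\<^sub>C m - b) = m + k *\<^sub>C b"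
      using False by (simp add: complex_vector.scale_right_diff_distrib)
    finally show ?thesis .
  qed simp
  show ?thesis
    unfolding closed_sequential_limits
  proof (intro allI impI, elim conjE)
    fix x l assume "\<forall>n. x n \<in> complex_vector.span (insert b S)" and lim: "x \<longlonglongrightarrow> l"
    then obtain k where k: "\<And>n. x n - k n *\<^sub>C b \<in> complex_vector.span S"
      unfolding complex_vector.span_insert mem_Collect_eq by metis
    have kd: "cmod (k n - k m) \<le> norm (x n - x m) / d" for n m
    proof -
      have "(x n - k n *\<^sub>C b) - (x m - k m *\<^sub>C b) \<in> complex_vector.span S"
        by (intro complex_vector.span_diff k)
      from bound[OF this, of "k n - k m"] show ?thesis
        using d(1) by (simp add: pos_le_divide_eq complex_vector.scale_left_diff_distrib algebra_simps)
    qed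
    have "Cauchy k"
    proof (rule CauchyI)
      fix e :: real assume "e > 0"
      moreover have "Cauchy x" using lim by (rule LIMSEQ_imp_Cauchy)
      ultimately obtain N where N: "\<forall>m\<ge>N. \<forall>n\<ge>N. norm (x m - x n) < e * d"
        using CauchyD[of x "e * d"] d(1) by auto
      then have "\<forall>m\<ge>N. \<forall>n\<ge>N. cmod (k m - k n) < e"
        using kd d(1) by (meson divide_less_eq le_less_trans mult_pos_pos)
      then show "\<exists>N. \<forall>m\<ge>N. \<forall>n\<ge>N. cmod (k m - k n) < e" by blast
    qed
    then obtain c where "k \<longlonglongrightarrow> c" using Cauchy_convergent convergent_def by blast
    then have "(\<lambda>n. x n - k n *\<^sub>C b) \<longlonglongrightarrow> l - c *\<^sub>C b"
      using lim by (intro tendsto_diff tendsto_scaleC_left)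
    then have "l - c *\<^sub>C b \<in> complex_vector.span S"
      by (rule closed_sequentially[OF closed k])
    then show "l \<in> complex_vector.span (insert b S)"
      unfolding complex_vector.span_insert by blast
  qed
qed

lemma closed_span_Un_finite:
  assumes "closed (complex_vector.span S)" "finite B"
  shows "closed (complex_vector.span (S \<union> B))"
  using assms(2,1) by (induction B rule: finite_induct) (auto intro: closed_span_insert)

lemma finite_dim_eq_span:
  assumes "complex_vector.subspace V" "cdim V < \<infinity>"
  obtains B where "finite B" "V = complex_vector.span B"
proof -
  obtain B where B: "finite B" "B \<subseteq> V" "V \<subseteq> complex_vector.span B"
    using finite_basis[OF assms(2)] by metis
  then have "V = complex_vector.span B"
    using complex_vector.span_minimal[OF B(2) assms(1)] by blast
  then show thesis using that B(1) by blast
qed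

lemma closed_finite_dim:
  assumes "complex_vector.subspace V" "cdim V < \<infinity>"
  shows "closed V"
proof -
  obtain B where "finite B" "V = complex_vector.span B" by (rule finite_dim_eq_span[OF assms])
  then show ?thesis using closed_span_Un_finite[of "{}" B] by simp
qed

section \<open>Operators with closed range\<close>

text \<open>
  First half of the open mapping theorem. The closed range is a complete metric space and the union of
  the closures of the images of balls, so by Baire one closure contains a relative ball around some \<open>y0\<close>.
  Subtracting \<open>y0\<close> moves this ball to the origin, and scaling gives approximate preimages of every vector
  in the range with a uniform bound. An error of half the norm is small enough for the iteration that
  makes them exact.
\<close>

lemma closed_range_approximate_preimage:
  fixes f :: "'a :: banach \<Rightarrow> 'b :: banach"
  assumes f: "bounded_linear f" and closed: "closed (range f)"
  obtains K where "K \<ge> 0" "\<And>y. y \<in> range f \<Longrightarrow> \<exists>x. norm x \<le> K * norm y \<and> norm (y - f x) \<le> norm y / 2"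
proof -
  interpret f: bounded_linear f by (fact f)
  let ?V = "range f" and ?X = "top_of_set (range f)"
  define G where "G n = closure (f ` cball 0 (real n))" for n
  have GV: "G n \<subseteq> ?V" for n
    unfolding G_def by (rule closure_minimal) (use closed in auto)
  have "y \<in> (\<Union>n. G n)" if "y \<in> ?V" for y
  proof -
    obtain x where "y = f x" using \<open>y \<in> ?V\<close> by blast
    moreover obtain n where "norm x \<le> real n" using real_arch_simple by blast
    ultimately have "y \<in> f ` cball 0 (real n)" by auto
    then have "y \<in> G n" unfolding G_def by (rule subsetD[OF closure_subset])
    then show ?thesis by blast
  qed
  then have un: "(\<Union>n. G n) = ?V" using GV by blast
  have comp: "completely_metrizable_space ?X"
    using completely_metrizable_space_closedin[OF completely_metrizable_space_euclidean]
      closed by simp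
  have "closedin ?X (G n)" for n
    using GV by (auto simp: G_def intro!: closed_subset)
  moreover have "?X interior_of \<Union>(range G) \<noteq> {}"
    unfolding un by (metis UNIV_I empty_iff image_eqI interior_of_topspace topspace_euclidean_subtopology)
  ultimately have "\<not> (\<forall>n. ?X interior_of G n = {})"
    using Baire_category_alt[of ?X "range G"] comp by fastforce
  then obtain n where "?X interior_of G n \<noteq> {}" by blast
  then obtain T y0 where T: "openin ?X T" "y0 \<in> T" "T \<subseteq> G n"
    unfolding interior_of_def by auto
  then obtain e where e: "e > 0" "\<And>y. y \<in> ?V \<Longrightarrow> dist y y0 < e \<Longrightarrow> y \<in> G n"
    unfolding openin_euclidean_subtopology_iff by blast
  have y0: "y0 \<in> ?V" "y0 \<in> G n" using T GV by auto
  have near: "\<exists>x. norm x \<le> 2 * real n \<and> norm (y - f x) < d"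
    if y: "y \<in> ?V" "norm y < e" and d: "d > 0" for y d
  proof -
    have approx: "\<exists>x. norm x \<le> real n \<and> dist (f x) z < d / 2" if "z \<in> G n" for z
    proof -
      have "\<exists>w\<in>f ` cball 0 (real n). dist w z < d / 2"
        using that half_gt_zero[OF d] unfolding G_def closure_approachable by blast
      then show ?thesis by auto
    qed
    have "y0 + y \<in> ?V" using y(1) y0(1) by (auto simp flip: f.add)
    then have "y0 + y \<in> G n" using e(2) y(2) by (simp add: dist_norm)
    then obtain x1 where x1: "norm x1 \<le> real n" "dist (f x1) (y0 + y) < d / 2"
      using approx by blast
    obtain x2 where x2: "norm x2 \<le> real n" "dist (f x2) y0 < d / 2"
      using approx[OF y0(2)] by blast
    have "norm (x1 - x2) \<le> 2 * real n"
      using x1(1) x2(1) norm_triangle_ineq4[of x1 x2] by linarith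
    moreover have "norm ((f x2 - y0) - (f x1 - (y0 + y))) < d"
      using x1(2) x2(2) norm_triangle_ineq4[of "f x2 - y0" "f x1 - (y0 + y)"]
      unfolding dist_norm by linarith
    moreover have "(f x2 - y0) - (f x1 - (y0 + y)) = y - f (x1 - x2)"
      by (simp add: f.diff algebra_simps)
    ultimately have "norm (x1 - x2) \<le> 2 * real n \<and> norm (y - f (x1 - x2)) < d" by simp
    then show ?thesis by blast
  qed
  define K where "K = 4 * real n / e"
  have "\<exists>x. norm x \<le> K * norm y \<and> norm (y - f x) \<le> norm y / 2" if y: "y \<in> ?V" for y
  proof (cases "y = 0")
    case True
    then show ?thesis by (intro exI[of _ 0]) (simp add: f.zero)
  next
    case False
    \<comment> \<open>The factor \<open>t\<close> shrinks or stretches \<open>y\<close> to norm \<open>e / 2\<close>, so an error \<open>e / 4\<close> there is half the norm.\<close>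
    define t where "t = e / (2 * norm y)"
    have t: "t > 0" using False e(1) by (simp add: t_def)
    have "t *\<^sub>R y \<in> ?V" using y by (auto simp flip: f.scaleR)
    moreover have "norm (t *\<^sub>R y) < e" using False e(1) by (simp add: t_def)
    ultimately obtain x where x: "norm x \<le> 2 * real n" "norm (t *\<^sub>R y - f x) < e / 4"
      using near[of "t *\<^sub>R y" "e / 4"] e(1) by auto
    have small: "norm ((1 / t) *\<^sub>R x) \<le> K * norm y"
      using x(1) t e(1) False by (simp add: t_def K_def field_simps)
    have "y - f ((1 / t) *\<^sub>R x) = (1 / t) *\<^sub>R (t *\<^sub>R y - f x)"
      using t by (simp add: f.scaleR scaleR_diff_right)
    then have "norm (y - f ((1 / t) *\<^sub>R x)) = norm (t *\<^sub>R y - f x) / t" using t by simp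
    then have "norm (y - f ((1 / t) *\<^sub>R x)) \<le> (e / 4) / t"
      using divide_right_mono[OF less_imp_le[OF x(2)] less_imp_le[OF t]] by (simp only:)
    also have "(e / 4) / t = norm y / 2" using e(1) by (simp add: t_def)
    finally show ?thesis using small by blast
  qed
  moreover have "K \<ge> 0" using e(1) by (simp add: K_def)
  ultimately show thesis using that by blast
qed

text \<open>
  The approximate preimages of the successive errors have norms dominated by a geometric series; their
  sum is an exact preimage.
\<close>

lemma closed_range_bounded_preimage:
  fixes f :: "'a :: banach \<Rightarrow> 'b :: banach"
  assumes f: "bounded_linear f" and closed: "closed (range f)"
  obtains C where "\<And>y. y \<in> range f \<Longrightarrow> \<exists>x. f x = y \<and> norm x \<le> C * norm y"
proof -
  interpret f: bounded_linear f by (fact f)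
  obtain K where K: "K \<ge> 0"
    "\<And>y. y \<in> range f \<Longrightarrow> \<exists>x. norm x \<le> K * norm y \<and> norm (y - f x) \<le> norm y / 2"
    using closed_range_approximate_preimage[OF assms] by blast
  then obtain h where h: "\<And>y. y \<in> range f \<Longrightarrow> norm (h y) \<le> K * norm y"
    "\<And>y. y \<in> range f \<Longrightarrow> norm (y - f (h y)) \<le> norm y / 2"
    by metis
  have "\<exists>x. f x = y \<and> norm x \<le> (2 * K) * norm y" if y: "y \<in> range f" for y
  proof -
    define r where "r k = ((\<lambda>z. z - f (h z)) ^^ k) y" for k
    have r0: "r 0 = y" and rS: "r (Suc k) = r k - f (h (r k))" for k by (simp_all add: r_def)
    have rV: "r k \<in> range f" for k
      by (induction k) (use y in \<open>auto simp: r0 rS simp flip: f.diff\<close>)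
    have rn: "norm (r k) \<le> norm y * (1 / 2) ^ k" for k
    proof (induction k)
      case (Suc k)
      have "norm (r (Suc k)) \<le> norm (r k) / 2" using h(2)[OF rV] by (simp add: rS)
      then show ?case using Suc by simp
    qed (simp add: r0)
    have hn: "norm (h (r k)) \<le> K * norm y * (1 / 2) ^ k" for k
      using h(1)[OF rV[of k]] mult_left_mono[OF rn[of k] K(1)] by (simp add: mult.assoc)
    have geo: "(\<lambda>k. K * norm y * (1 / 2) ^ k) sums (K * norm y * 2)"
      using sums_mult[OF geometric_sums[of "1 / 2 :: real"], of "K * norm y"] by simp
    have summ: "summable (\<lambda>k. norm (h (r k)))"
      by (rule summable_comparison_test'[OF sums_summable[OF geo]]) (use hn in auto)
    then have "f (\<Sum>k. h (r k)) = (\<Sum>k. f (h (r k)))"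
      by (simp add: f.suminf summable_norm_cancel)
    also have "(\<lambda>k. f (h (r k))) = (\<lambda>k. r k - r (Suc k))" by (simp add: rS)
    also have "(\<lambda>k. r k - r (Suc k)) sums (r 0 - 0)"
    proof (rule telescope_sums')
      have "(\<lambda>k. norm y * (1 / 2) ^ k) \<longlonglongrightarrow> norm y * 0"
        by (intro tendsto_mult LIMSEQ_power_zero tendsto_const) auto
      then show "r \<longlonglongrightarrow> 0"
        using rn by (intro Lim_null_comparison[of r]) auto
    qed
    then have "(\<Sum>k. r k - r (Suc k)) = y" by (simp add: sums_iff r0)
    finally have "f (\<Sum>k. h (r k)) = y" .
    moreover have "norm (\<Sum>k. h (r k)) \<le> (\<Sum>k. norm (h (r k)))" by (rule summable_norm[OF summ])
    moreover have "(\<Sum>k. norm (h (r k))) \<le> (\<Sum>k. K * norm y * (1 / 2) ^ k)"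
      using hn summ sums_summable[OF geo] by (rule suminf_le)
    moreover have "(\<Sum>k. K * norm y * (1 / 2) ^ k) = K * norm y * 2" using geo by (rule sums_unique[symmetric])
    ultimately show ?thesis by (intro exI[of _ "\<Sum>k. h (r k)"]) (simp add: mult_ac)
  qed
  then show thesis by (rule that)
qed

text \<open>
  The form in which the open mapping theorem is used: null sequences in a closed range lift to null
  sequences.
\<close>

lemma null_sequence_lift:
  fixes f :: "'a :: banach \<Rightarrow> 'b :: banach"
  assumes "bounded_linear f" "closed (range f)" "\<And>n. y n \<in> range f" "y \<longlonglongrightarrow> 0"
  shows "\<exists>z. (\<forall>n. f (z n) = y n) \<and> z \<longlonglongrightarrow> 0"
proof -
  obtain C where "\<And>y. y \<in> range f \<Longrightarrow> \<exists>x. f x = y \<and> norm x \<le> C * norm y"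
    using closed_range_bounded_preimage[OF assms(1,2)] by blast
  then have "\<forall>n. \<exists>x. f x = y n \<and> norm x \<le> C * norm (y n)" using assms(3) by blast
  then obtain z where z: "\<And>n. f (z n) = y n" "\<And>n. norm (z n) \<le> C * norm (y n)"
    by metis
  have "(\<lambda>n. C * norm (y n)) \<longlonglongrightarrow> C * 0"
    using assms(4) by (intro tendsto_mult tendsto_const tendsto_norm_zero)
  then have "z \<longlonglongrightarrow> 0" using z(2) by (intro Lim_null_comparison[of z]) auto
  then show ?thesis using z(1) by blast
qed

text \<open>
  A sequence \<open>f (m n)\<close> that converges to some \<open>f w\<close> differs from it by the image of a null sequence \<open>z\<close>, so that
  \<open>w + z n\<close> lies in the subspace \<open>M + kernel f\<close>. This is closed because the kernel is finite-dimensional, and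
  its image is the image of \<open>M\<close>.
\<close>

lemma closed_image_subspace:
  fixes f :: "'a :: complex_banach \<Rightarrow> 'b :: complex_banach"
  assumes f: "bounded_clinear f" "closed (range f)" "cdim (kernel f) < \<infinity>"
    and M: "complex_vector.subspace M" "closed M"
  shows "closed (f ` M)"
proof -
  interpret f: bounded_linear f using f(1) by (simp add: bounded_clinear_def)
  have lin: "Vector_Spaces.linear scaleC scaleC f" by (rule bounded_clinear_imp_linear[OF f(1)])
  interpret cf: Vector_Spaces.linear scaleC scaleC f by (fact lin)
  obtain B where B: "finite B" "kernel f = complex_vector.span B"
    using finite_dim_eq_span[OF subspace_kernel[OF lin] f(3)] .
  define N where "N = complex_vector.span (M \<union> B)"
  have N: "closed N" using closed_span_Un_finite[of M] M B(1)
    by (simp add: N_def complex_vector.span_eq_iff[THEN iffD2])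
  have N_eq: "N = {m + k | m k. m \<in> M \<and> k \<in> kernel f}"
    unfolding N_def complex_vector.span_Un B(2) using M(1) by (simp add: complex_vector.span_eq_iff[THEN iffD2])
  show ?thesis
    unfolding closed_sequential_limits
  proof (intro allI impI, elim conjE)
    fix y l assume "\<forall>n. y n \<in> f ` M" and lim: "y \<longlonglongrightarrow> l"
    then have "\<forall>n. \<exists>m. m \<in> M \<and> y n = f m" by blast
    then obtain m where m: "\<And>n. m n \<in> M" "\<And>n. y n = f (m n)" by metis
    have "l \<in> range f" using closed_sequentially[OF f(2) _ lim] m(2) by auto
    then obtain w where w: "l = f w" by blast
    have "y n - l \<in> range f" for n using rangeI[of f "m n - w"] by (simp add: f.diff m(2) w)
    moreover have "(\<lambda>n. y n - l) \<longlonglongrightarrow> 0" using lim by (simp add: LIM_zero)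
    ultimately have "\<exists>z. (\<forall>n. f (z n) = y n - l) \<and> z \<longlonglongrightarrow> 0"
      by (rule null_sequence_lift[OF f.bounded_linear_axioms f(2)])
    then obtain z where z: "\<And>n. f (z n) = y n - l" "z \<longlonglongrightarrow> 0" by blast
    have "w + z n \<in> N" for n
    proof -
      have "w + z n - m n \<in> kernel f" by (simp add: kernel_def f.diff f.add z(1) m(2) w)
      moreover have "w + z n = m n + (w + z n - m n)" by simp
      ultimately show ?thesis unfolding N_eq using m(1) by blast
    qed
    moreover have "(\<lambda>n. w + z n) \<longlonglongrightarrow> w + 0" using z(2) by (intro tendsto_intros)
    ultimately have "w + 0 \<in> N" by (rule closed_sequentially[OF N])
    then have "w \<in> N" by simp
    then show "l \<in> f ` M" unfolding N_eq w by (auto simp: kernel_def f.add)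
  qed
qed

text \<open>
  If \<open>f (x n)\<close> converges to \<open>l\<close>, then applying \<open>g\<close> and lifting in the closed range of \<open>g \<circ> f\<close> changes the \<open>x n\<close>,
  up to a fixed vector and a null sequence, into elements of the kernel of \<open>g \<circ> f\<close>. Their images lie in a
  finite-dimensional space, which is closed. With \<open>g\<close> a power of \<open>f\<close>, this passes from the closed range in the
  definition of a left pole to the closed range in the definition of a semi-Fredholm operator.
\<close>

lemma closed_range_of_comp:
  fixes f :: "'a :: complex_banach \<Rightarrow> 'b :: complex_banach"
    and g :: "'b \<Rightarrow> 'c :: complex_banach"
  assumes f: "bounded_clinear f" and g: "bounded_clinear g"
    and gf: "closed (range (g \<circ> f))" "cdim (kernel (g \<circ> f)) < \<infinity>"
  shows "closed (range f)"
proof -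
  interpret f: bounded_linear f using f(1) by (simp add: bounded_clinear_def)
  interpret g: bounded_linear g using g(1) by (simp add: bounded_clinear_def)
  have lin: "Vector_Spaces.linear scaleC scaleC f" by (rule bounded_clinear_imp_linear[OF f(1)])
  interpret cf: Vector_Spaces.linear scaleC scaleC f by (fact lin)
  have bgf: "bounded_clinear (g \<circ> f)" using g f by (rule bounded_clinear_compose)
  let ?L = "f ` kernel (g \<circ> f)"
  have "closed ?L"
    using subspace_kernel[OF bounded_clinear_imp_linear[OF bgf]] gf(2)
    by (intro closed_finite_dim cf.subspace_image cdim_finite_image lin)
  show ?thesis
    unfolding closed_sequential_limits
  proof (intro allI impI, elim conjE)
    fix y l assume "\<forall>n. y n \<in> range f" and lim: "y \<longlonglongrightarrow> l"
    then have "\<forall>n. \<exists>x. y n = f x" by blast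
    then obtain x where x: "\<And>n. y n = f (x n)" by metis
    have lim': "(\<lambda>n. g (y n)) \<longlonglongrightarrow> g l" using lim by (rule g.tendsto)
    have "g l \<in> range (g \<circ> f)" using closed_sequentially[OF gf(1) _ lim'] x by auto
    then obtain w where w: "g l = g (f w)" by auto
    have "(\<lambda>n. g (y n) - g l) \<longlonglongrightarrow> 0" using lim' by (simp add: LIM_zero)
    moreover have "g (y n) - g l \<in> range (g \<circ> f)" for n
      using rangeI[of "g \<circ> f" "x n - w"] by (simp add: x w f.diff g.diff)
    moreover have "bounded_linear (g \<circ> f)" using bgf by (simp add: bounded_clinear_def)
    ultimately have "\<exists>z. (\<forall>n. (g \<circ> f) (z n) = g (y n) - g l) \<and> z \<longlonglongrightarrow> 0"
      by (intro null_sequence_lift[OF _ gf(1)])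
    then obtain z where z: "\<And>n. g (f (z n)) = g (y n) - g l" "z \<longlonglongrightarrow> 0" by auto
    have "y n - f w - f (z n) \<in> ?L" for n
    proof (rule image_eqI)
      show "y n - f w - f (z n) = f (x n - w - z n)" by (simp add: x f.diff)
      show "x n - w - z n \<in> kernel (g \<circ> f)" by (simp add: kernel_def f.diff g.diff z(1) w x)
    qed
    moreover have "(\<lambda>n. y n - f w - f (z n)) \<longlonglongrightarrow> l - f w - f 0"
      using lim z(2) by (intro tendsto_diff tendsto_const f.tendsto)
    ultimately have "l - f w - f 0 \<in> ?L" by (rule closed_sequentially[OF \<open>closed ?L\<close>])
    then have "l - f w \<in> ?L" by (simp only: f.zero diff_zero)
    then obtain u where "l = f (u + w)" by (auto simp: f.add algebra_simps)
    then show "l \<in> range f" by blast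
  qed
qed

section \<open>Powers and ascent\<close>

lemma kernel_funpow_Suc: "kernel (T ^^ Suc n) = T -` kernel (T ^^ n)"
  by (auto simp: kernel_def funpow_swap1)

lemma nullity_funpow_finite:
  assumes T: "bounded_clinear T" and "nullity T < \<infinity>"
  shows "nullity (T ^^ n) < \<infinity>"
proof (induction n)
  case 0
  have "kernel (id :: 'a \<Rightarrow> 'a) \<subseteq> complex_vector.span {}" by (auto simp: kernel_def)
  then show ?case unfolding nullity_def cdim_finite_iff by force
next
  case (Suc n)
  then show ?case
    using cdim_finite_vimage[OF bounded_clinear_imp_linear[OF T]] assms(2)
    unfolding nullity_def kernel_funpow_Suc by blast
qed

text \<open>
  The range of the next power is the image of a closed subspace under a semi-Fredholm operator.
\<close>

lemma closed_range_funpow: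
  fixes T :: "'a :: complex_banach \<Rightarrow> 'a"
  assumes T: "bounded_clinear T" and "upper_semi_Fredholm T"
  shows "closed (range (T ^^ n))"
proof (induction n)
  case (Suc n)
  interpret Tn: Vector_Spaces.linear scaleC scaleC "T ^^ n"
    by (intro bounded_clinear_imp_linear bounded_clinear_funpow T)
  have "range (T ^^ Suc n) = T ` range (T ^^ n)" by auto
  moreover have "complex_vector.subspace (range (T ^^ n))" by (simp add: Tn.subspace_image)
  ultimately show ?case
    using closed_image_subspace[OF T] assms(2) Suc
    by (simp add: upper_semi_Fredholm_def nullity_def)
qed simp

lemma ascent_finite_iff: "ascent T < \<infinity> \<longleftrightarrow> (\<exists>n. kernel (T ^^ n) = kernel (T ^^ Suc n))"
proof
  assume "ascent T < \<infinity>"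
  then show "\<exists>n. kernel (T ^^ n) = kernel (T ^^ Suc n)"
    unfolding ascent_def by (auto simp: Inf_enat_def split: if_splits)
next
  assume "\<exists>n. kernel (T ^^ n) = kernel (T ^^ Suc n)"
  then obtain n where "kernel (T ^^ n) = kernel (T ^^ Suc n)" by blast
  then have "ascent T \<le> enat n" unfolding ascent_def by (intro Inf_lower) blast
  then show "ascent T < \<infinity>" by (metis enat_ord_code(4) order_le_less_trans)
qed

lemma kernel_funpow_stable:
  fixes T :: "'a :: complex_normed_vector \<Rightarrow> 'a"
  assumes "kernel (T ^^ n) = kernel (T ^^ Suc n)" "n \<le> m"
  shows "kernel (T ^^ m) = kernel (T ^^ Suc m)"
  using assms(2)
proof (induction m rule: dec_induct)
  case base
  show ?case by (fact assms(1))
next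
  case (step m)
  then show ?case by (metis kernel_funpow_Suc)
qed

section \<open>Upper semi-Browder operators and left poles\<close>

definition upper_semi_Browder :: "('a :: complex_normed_vector \<Rightarrow> 'a) \<Rightarrow> bool" where
  "upper_semi_Browder T \<longleftrightarrow> upper_semi_Fredholm T \<and> ascent T < \<infinity>"

definition upper_semi_Browder_spectrum :: "('a :: complex_normed_vector \<Rightarrow> 'a) \<Rightarrow> complex set" where
  "upper_semi_Browder_spectrum T = {l. \<not> upper_semi_Browder (shift T l)}"

text \<open>
  The kernel \<open>K\<close> of the power at which the kernels stabilise is finite-dimensional and equals its own
  preimage under \<open>T\<close>, which is the situation of \<open>cdim_kernel_le_codim_range\<close>.
\<close>

lemma upper_semi_Browder_imp_Weyl:
  assumes T: "bounded_clinear T" and Browder: "upper_semi_Browder T"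
  shows "upper_semi_Weyl T"
proof -
  obtain n where n: "kernel (T ^^ n) = kernel (T ^^ Suc n)"
    using Browder unfolding upper_semi_Browder_def ascent_finite_iff by blast
  have "nullity (T ^^ n) < \<infinity>"
    using nullity_funpow_finite[OF T] Browder
    by (simp add: upper_semi_Browder_def upper_semi_Fredholm_def)
  then have "nullity T \<le> deficiency T"
    using cdim_kernel_le_codim_range[of T "kernel (T ^^ n)"] n
    unfolding nullity_def deficiency_def kernel_funpow_Suc
    by (simp add: T bounded_clinear_imp_linear bounded_clinear_funpow subspace_kernel)
  then have "index T \<le> 0" using Browder
    unfolding index_def upper_semi_Browder_def upper_semi_Fredholm_def
    by (cases "nullity T"; cases "deficiency T") auto
  then show ?thesis using Browder by (simp add: upper_semi_Weyl_def upper_semi_Browder_def)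
qed

text \<open>
  With finite nullity, closedness of the range of the power \<open>p + 1\<close> is equivalent to closedness of the
  range of the operator itself. The two directions are \<open>closed_range_of_comp\<close> and \<open>closed_range_funpow\<close>.
\<close>

lemma left_poles_finite_rank_eq:
  fixes T :: "'a :: complex_banach \<Rightarrow> 'a"
  assumes T: "bounded_clinear T"
  shows "left_poles_finite_rank T = approximate_point_spectrum T - upper_semi_Browder_spectrum T"
proof -
  have "(\<exists>p. ascent (shift T l) = enat p \<and> closed (range (shift T l ^^ (p + 1))))
        \<and> nullity (shift T l) < \<infinity> \<longleftrightarrow> upper_semi_Browder (shift T l)" (is "?L \<longleftrightarrow> ?R") for l
  proof
    have A: "bounded_clinear (shift T l)" using T by (rule bounded_clinear_shift)
    {
      assume ?L
      then obtain p where p: "ascent (shift T l) = enat p" "closed (range (shift T l ^^ Suc p))"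
        "nullity (shift T l) < \<infinity>" by auto
      have "closed (range (shift T l))"
      proof (rule closed_range_of_comp[OF A bounded_clinear_funpow[OF A]])
        show "closed (range (shift T l ^^ p \<circ> shift T l))"
          using p(2) by (simp only: funpow_Suc_right)
        show "cdim (kernel (shift T l ^^ p \<circ> shift T l)) < \<infinity>"
          using nullity_funpow_finite[OF A p(3), of "Suc p"]
          by (simp only: funpow_Suc_right nullity_def)
      qed
      then show ?R using p by (simp add: upper_semi_Browder_def upper_semi_Fredholm_def)
    next
      assume ?R
      then have F: "upper_semi_Fredholm (shift T l)" and "ascent (shift T l) < \<infinity>"
        by (simp_all add: upper_semi_Browder_def)
      then obtain p where "ascent (shift T l) = enat p" by auto
      then show ?L using closed_range_funpow[OF A F] F unfolding upper_semi_Fredholm_def by blast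
    }
  qed
  then show ?thesis
    unfolding left_poles_finite_rank_def left_pole_def upper_semi_Browder_spectrum_def by auto
qed

lemma approximate_point_spectrum_subset: "approximate_point_spectrum T \<subseteq> spectrum T"
proof (intro subsetI, rule ccontr)
  fix l assume "l \<in> approximate_point_spectrum T" "l \<notin> spectrum T"
  then obtain x U where x: "\<And>n. norm (x n) = 1" "(\<lambda>n. shift T l (x n)) \<longlonglongrightarrow> 0"
    and U: "bounded_clinear U" "U \<circ> shift T l = id"
    unfolding approximate_point_spectrum_def spectrum_def by blast
  interpret U: bounded_linear U using U(1) by (simp add: bounded_clinear_def)
  have "(\<lambda>n. U (shift T l (x n))) \<longlonglongrightarrow> U 0" using x(2) by (rule U.tendsto)
  then have "x \<longlonglongrightarrow> 0" using U(2) by (simp add: U.zero pointfree_idE)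
  then have "(\<lambda>n. norm (x n)) \<longlonglongrightarrow> 0" by (rule tendsto_norm_zero)
  then show False using x(1) by (simp add: LIMSEQ_const_iff)
qed

lemma upper_semi_Browder_spectrum_subset: "upper_semi_Browder_spectrum T \<subseteq> spectrum T"
proof (intro subsetI, rule ccontr)
  fix l assume l: "l \<in> upper_semi_Browder_spectrum T" "l \<notin> spectrum T"
  define A where "A = shift T l"
  obtain U where U: "bounded_clinear U" "A \<circ> U = id" "U \<circ> A = id"
    using l(2) unfolding spectrum_def A_def by blast
  interpret U: bounded_linear U using U(1) by (simp add: bounded_clinear_def)
  have "range A = UNIV" using U(2) by (metis comp_surj surj_id surj_def comp_eq_dest_lhs id_apply)
  have A0: "A x = 0 \<longleftrightarrow> x = 0" for x
    using U by (metis U.zero comp_eq_dest_lhs id_apply)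
  then have ker: "kernel A = {0}" by (auto simp: kernel_def)
  then have "kernel A \<subseteq> complex_vector.span {}" by simp
  then have "nullity A < \<infinity>" unfolding nullity_def cdim_finite_iff by blast
  moreover have "ascent A < \<infinity>"
    unfolding ascent_finite_iff by (rule exI[of _ 0]) (use A0 in \<open>simp add: kernel_def\<close>)
  ultimately have "upper_semi_Browder A"
    using \<open>range A = UNIV\<close> by (simp add: upper_semi_Browder_def upper_semi_Fredholm_def)
  then show False using l(1) by (simp add: upper_semi_Browder_spectrum_def A_def)
qed

text \<open>
  The form of property \<open>(az)\<close> that behaves well under direct sums. Left poles of finite rank are the
  approximate point spectrum without the Browder spectrum, and both the Weyl spectrum is contained in
  the Browder spectrum and the Browder spectrum in the spectrum; the rest is set theory.
\<close>

lemma property_az_iff: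
  fixes T :: "'a :: complex_banach \<Rightarrow> 'a"
  assumes T: "bounded_clinear T"
  shows "property_az T \<longleftrightarrow> upper_semi_Weyl_spectrum T = upper_semi_Browder_spectrum T
    \<and> spectrum T - upper_semi_Weyl_spectrum T \<subseteq> approximate_point_spectrum T"
proof -
  have "upper_semi_Weyl_spectrum T \<subseteq> upper_semi_Browder_spectrum T"
    using upper_semi_Browder_imp_Weyl[OF bounded_clinear_shift[OF T]]
    by (auto simp: upper_semi_Weyl_spectrum_def upper_semi_Browder_spectrum_def)
  then show ?thesis
    using approximate_point_spectrum_subset[of T] upper_semi_Browder_spectrum_subset[of T]
    unfolding property_az_def left_poles_finite_rank_eq[OF T] by blast
qed

section \<open>Direct sums\<close>

lemma shift_map_prod: "shift (S \<oplus>\<^sub>o T) l = shift S l \<oplus>\<^sub>o shift T l"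
  by (auto simp: shift_def scaleC_prod_def)

lemma kernel_map_prod: "kernel (S \<oplus>\<^sub>o T) = kernel S \<times> kernel T"
  by (auto simp: kernel_def zero_prod_def)

lemma funpow_map_prod: "(S \<oplus>\<^sub>o T) ^^ n = (S ^^ n) \<oplus>\<^sub>o (T ^^ n)"
  by (induction n) (auto simp: map_prod.comp)

lemma closed_Times_iff:
  fixes V :: "'a :: topological_space set" and W :: "'b :: topological_space set"
  assumes "V \<noteq> {}" "W \<noteq> {}"
  shows "closed (V \<times> W) \<longleftrightarrow> closed V \<and> closed W"
proof
  assume closed: "closed (V \<times> W)"
  obtain v w where "v \<in> V" "w \<in> W" using assms by blast
  then have "V = (\<lambda>x. (x, w)) -` (V \<times> W)" "W = (\<lambda>y. (v, y)) -` (V \<times> W)" by auto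
  moreover have "closed ((\<lambda>x. (x, w)) -` (V \<times> W))" "closed ((\<lambda>y. (v, y)) -` (V \<times> W))"
    by (rule closed_vimage[OF closed], intro continuous_intros)+
  ultimately show "closed V \<and> closed W" by simp
qed (simp add: closed_Times)

text \<open>
  Once the kernels of the powers of an operator stabilise they stay constant, so the kernels of both
  summands are stable from the larger of the two indices on.
\<close>

lemma ascent_map_prod_finite_iff:
  assumes S: "bounded_clinear S" and T: "bounded_clinear T"
  shows "ascent (S \<oplus>\<^sub>o T) < \<infinity> \<longleftrightarrow> ascent S < \<infinity> \<and> ascent T < \<infinity>"
proof -
  have ne: "kernel (S ^^ n) \<noteq> {}" "kernel (T ^^ n) \<noteq> {}" for n
    using zero_in_kernel[OF bounded_clinear_funpow[OF S]]
      zero_in_kernel[OF bounded_clinear_funpow[OF T]] by blast+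
  have "ascent (S \<oplus>\<^sub>o T) < \<infinity>
      \<longleftrightarrow> (\<exists>n. kernel (S ^^ n) = kernel (S ^^ Suc n) \<and> kernel (T ^^ n) = kernel (T ^^ Suc n))"
    unfolding ascent_finite_iff funpow_map_prod kernel_map_prod times_eq_iff using ne by simp
  also have "\<dots> \<longleftrightarrow> ascent S < \<infinity> \<and> ascent T < \<infinity>"
    unfolding ascent_finite_iff
    by (metis kernel_funpow_stable max.cobounded1 max.cobounded2)
  finally show ?thesis .
qed

lemma upper_semi_Fredholm_map_prod_iff:
  assumes S: "bounded_clinear S" and T: "bounded_clinear T"
  shows "upper_semi_Fredholm (S \<oplus>\<^sub>o T) \<longleftrightarrow> upper_semi_Fredholm S \<and> upper_semi_Fredholm T"
proof -
  have ne: "kernel S \<noteq> {}" "kernel T \<noteq> {}"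
    using zero_in_kernel[OF S] zero_in_kernel[OF T] by blast+
  have "range (S \<oplus>\<^sub>o T) = range S \<times> range T" by force
  then show ?thesis
    unfolding upper_semi_Fredholm_def nullity_def kernel_map_prod cdim_finite_Times_iff[OF ne]
    by (auto simp: closed_Times_iff)
qed

text \<open>
  In contrast to the Weyl condition, where the negative index of one summand can compensate the positive
  index of the other, the Browder condition on a direct sum splits into conditions on the summands.
\<close>

lemma upper_semi_Browder_spectrum_map_prod:
  assumes "bounded_clinear S" "bounded_clinear T"
  shows "upper_semi_Browder_spectrum (S \<oplus>\<^sub>o T)
    = upper_semi_Browder_spectrum S \<union> upper_semi_Browder_spectrum T"
proof -
  have "upper_semi_Browder (shift (S \<oplus>\<^sub>o T) l)
      \<longleftrightarrow> upper_semi_Browder (shift S l) \<and> upper_semi_Browder (shift T l)" for l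
    unfolding upper_semi_Browder_def shift_map_prod
      upper_semi_Fredholm_map_prod_iff[OF bounded_clinear_shift bounded_clinear_shift, OF assms]
      ascent_map_prod_finite_iff[OF bounded_clinear_shift bounded_clinear_shift, OF assms]
    by blast
  then show ?thesis unfolding upper_semi_Browder_spectrum_def by blast
qed

lemma spectrum_map_prod_subset: "spectrum (S \<oplus>\<^sub>o T) \<subseteq> spectrum S \<union> spectrum T"
proof (intro subsetI, rule ccontr)
  fix l assume l: "l \<in> spectrum (S \<oplus>\<^sub>o T)" "l \<notin> spectrum S \<union> spectrum T"
  then obtain U V where "bounded_clinear U" "shift S l \<circ> U = id" "U \<circ> shift S l = id"
    "bounded_clinear V" "shift T l \<circ> V = id" "V \<circ> shift T l = id"
    unfolding spectrum_def by blast
  then have "bounded_clinear (U \<oplus>\<^sub>o V)" "shift (S \<oplus>\<^sub>o T) l \<circ> (U \<oplus>\<^sub>o V) = id"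
    "(U \<oplus>\<^sub>o V) \<circ> shift (S \<oplus>\<^sub>o T) l = id"
    by (simp_all add: bounded_clinear_map_prod shift_map_prod map_prod.comp map_prod.id)
  then show False using l(1) unfolding spectrum_def by blast
qed

lemma approximate_point_spectrum_map_prod_superset:
  assumes S: "bounded_clinear S" and T: "bounded_clinear T"
  shows "approximate_point_spectrum S \<union> approximate_point_spectrum T
    \<subseteq> approximate_point_spectrum (S \<oplus>\<^sub>o T)"
proof -
  have zero: "shift S l 0 = 0" "shift T l 0 = 0" for l
    using bounded_clinear_shift[OF S] bounded_clinear_shift[OF T]
    by (auto simp: bounded_clinear_def bounded_linear.linear linear_0)
  have "l \<in> approximate_point_spectrum (S \<oplus>\<^sub>o T)" if l: "l \<in> approximate_point_spectrum S" for l
  proof -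
    obtain x where x: "\<And>n. norm (x n) = 1" "(\<lambda>n. shift S l (x n)) \<longlonglongrightarrow> 0"
      using l unfolding approximate_point_spectrum_def by blast
    have "(\<lambda>n. shift (S \<oplus>\<^sub>o T) l (x n, 0)) \<longlonglongrightarrow> (0, 0)"
      unfolding shift_map_prod map_prod_simp zero using x(2) by (intro tendsto_Pair tendsto_const)
    then show ?thesis
      unfolding approximate_point_spectrum_def zero_prod_def mem_Collect_eq
      using x(1) by (intro exI[of _ "\<lambda>n. (x n, 0)"]) (simp add: norm_Pair)
  qed
  moreover have "l \<in> approximate_point_spectrum (S \<oplus>\<^sub>o T)"
    if l: "l \<in> approximate_point_spectrum T" for l
  proof -
    obtain x where x: "\<And>n. norm (x n) = 1" "(\<lambda>n. shift T l (x n)) \<longlonglongrightarrow> 0"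
      using l unfolding approximate_point_spectrum_def by blast
    have "(\<lambda>n. shift (S \<oplus>\<^sub>o T) l (0, x n)) \<longlonglongrightarrow> (0, 0)"
      unfolding shift_map_prod map_prod_simp zero using x(2) by (intro tendsto_Pair tendsto_const)
    then show ?thesis
      unfolding approximate_point_spectrum_def zero_prod_def mem_Collect_eq
      using x(1) by (intro exI[of _ "\<lambda>n. (0, x n)"]) (simp add: norm_Pair)
  qed
  ultimately show ?thesis by blast
qed

section \<open>Property (az) of direct sums\<close>

theorem theorem3p5:
  fixes S :: "'a :: complex_banach \<Rightarrow> 'a" and T :: "'b :: complex_banach \<Rightarrow> 'b"
  assumes "cdim (UNIV :: 'a set) = \<infinity>" and "cdim (UNIV :: 'b set) = \<infinity>"
    and "bounded_clinear S" and "bounded_clinear T"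
    and "property_az S" and "property_az T"
  shows "property_az (S \<oplus>\<^sub>o T) \<longleftrightarrow>
         upper_semi_Weyl_spectrum (S \<oplus>\<^sub>o T)
           = upper_semi_Weyl_spectrum S \<union> upper_semi_Weyl_spectrum T"
proof -
  have ST: "bounded_clinear (S \<oplus>\<^sub>o T)" using assms(3,4) by (rule bounded_clinear_map_prod)
  have S: "upper_semi_Weyl_spectrum S = upper_semi_Browder_spectrum S"
    "spectrum S - upper_semi_Weyl_spectrum S \<subseteq> approximate_point_spectrum S"
    and T: "upper_semi_Weyl_spectrum T = upper_semi_Browder_spectrum T"
    "spectrum T - upper_semi_Weyl_spectrum T \<subseteq> approximate_point_spectrum T"
    using assms(3-6) property_az_iff by blast+
  have Browder: "upper_semi_Browder_spectrum (S \<oplus>\<^sub>o T)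
      = upper_semi_Weyl_spectrum S \<union> upper_semi_Weyl_spectrum T"
    using upper_semi_Browder_spectrum_map_prod[OF assms(3,4)] S(1) T(1) by simp
  show ?thesis
  proof
    assume "property_az (S \<oplus>\<^sub>o T)"
    then show "upper_semi_Weyl_spectrum (S \<oplus>\<^sub>o T)
        = upper_semi_Weyl_spectrum S \<union> upper_semi_Weyl_spectrum T"
      using Browder property_az_iff[OF ST] by simp
  next
    assume Weyl: "upper_semi_Weyl_spectrum (S \<oplus>\<^sub>o T)
        = upper_semi_Weyl_spectrum S \<union> upper_semi_Weyl_spectrum T"
    have "spectrum (S \<oplus>\<^sub>o T) - upper_semi_Weyl_spectrum (S \<oplus>\<^sub>o T)
        \<subseteq> approximate_point_spectrum S \<union> approximate_point_spectrum T"
      using spectrum_map_prod_subset[of S T] S(2) T(2) unfolding Weyl by blast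
    then show "property_az (S \<oplus>\<^sub>o T)"
      using Weyl Browder approximate_point_spectrum_map_prod_superset[OF assms(3,4)]
        property_az_iff[OF ST] by blast
  qed
qed

end
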